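(* The system of congruences $A_1\cong A_2\cong A_3$, $A_1\cup A_2\cong A_1\cup A_3$ cannot be satisfied by open subsets of $S^2$ with dense union using free rotations. That is, there do not exist pairwise disjoint open subsets $A_1,A_2,A_3$ of $S^2$ with $A_1\cup A_2\cup A_3$ dense in $S^2$, together with a free group $F$ of rotations of $S^2$, such that each of the congruences $A_1\cong A_2$, $A_2\cong A_3$, $A_1\cup A_2\cong A_1\cup A_3$ is witnessed by an element of $F$.
   Context: $S^2$ is the standard unit sphere in $\mathbb{R}^3$. A free group of rotations is a subgroup of the rotation group $SO(3)$ (acting on $S^2$) which is free as an abstract group. A congruence $B\cong C$ between subsets of $S^2$ is witnessed by $g$ if $g(B)=C$. *)

theory Defs
  imports "HOL-Algebra.Generated_Groups" "HOL-Analysis.Analysis"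
begin

definition SO3 :: "(real^3^3) monoid" where
  "SO3 = \<lparr> carrier = {Q. rotation_matrix Q}, monoid.mult = (**), one = mat 1 \<rparr>"

lemma group_SO3: "group SO3"
proof (rule groupI)
  fix x assume "x \<in> carrier SO3"
  then have x: "orthogonal_matrix x" "det x = 1"
    by (auto simp: SO3_def rotation_matrix_def)
  then have "transpose x \<in> carrier SO3" "transpose x ** x = mat 1"
    by (auto simp: SO3_def rotation_matrix_def orthogonal_matrix_def det_transpose)
  then show "\<exists>y\<in>carrier SO3. y \<otimes>\<^bsub>SO3\<^esub> x = \<one>\<^bsub>SO3\<^esub>"
    by (auto simp: SO3_def)
qed (auto simp: SO3_def rotation_matrix_def orthogonal_matrix_mul orthogonal_matrix_id
       det_mul matrix_mul_assoc)

(* A word is a list of letters; (True, x) stands for x and (False, x) for its formal inverse. *)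

fun letter_value :: "('a, 'b) monoid_scheme \<Rightarrow> bool \<times> 'a \<Rightarrow> 'a" where
  "letter_value G (e, x) = (if e then x else inv\<^bsub>G\<^esub> x)"

definition word_value :: "('a, 'b) monoid_scheme \<Rightarrow> (bool \<times> 'a) list \<Rightarrow> 'a" where
  "word_value G w = foldr (\<lambda>l g. letter_value G l \<otimes>\<^bsub>G\<^esub> g) w \<one>\<^bsub>G\<^esub>"

definition reduced_word :: "(bool \<times> 'a) list \<Rightarrow> bool" where
  "reduced_word w \<longleftrightarrow> successively (\<lambda>l m. \<not> (snd l = snd m \<and> fst l \<noteq> fst m)) w"

(* The rank is arbitrary: S may be empty (trivial group) or infinite. *)

definition free_basis :: "('a, 'b) monoid_scheme \<Rightarrow> 'a set \<Rightarrow> bool" where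
  "free_basis G S \<longleftrightarrow>
     S \<subseteq> carrier G \<and> generate G S = carrier G \<and>
     (\<forall>w. w \<noteq> [] \<and> snd ` set w \<subseteq> S \<and> reduced_word w \<longrightarrow> word_value G w \<noteq> \<one>\<^bsub>G\<^esub>)"

definition free_group :: "('a, 'b) monoid_scheme \<Rightarrow> bool" where
  "free_group G \<longleftrightarrow> group G \<and> (\<exists>S. free_basis G S)"

definition free_group_of_rotations :: "(real^3^3) set \<Rightarrow> bool" where
  "free_group_of_rotations F \<longleftrightarrow> subgroup F SO3 \<and> free_group (SO3\<lparr>carrier := F\<rparr>)"

abbreviation S2 :: "(real^3) set" where
  "S2 \<equiv> sphere 0 1"

definition witnesses_congruence :: "real^3^3 \<Rightarrow> (real^3) set \<Rightarrow> (real^3) set \<Rightarrow> bool" where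
  "witnesses_congruence g B C \<longleftrightarrow> (\<lambda>x. g *v x) ` B = C"

end

(*
  Write C_i for the closure of A_i, and let s, t, r in F map A_1 to A_2, A_2 to A_3 and A_1 \<union> A_2
  to A_1 \<union> A_3.  Free groups are torsion free, so every nontrivial rotation in F has infinite order
  and, by Kronecker's theorem, a closed set mapped into itself by it is invariant under all rotations
  about its axis ("zonal").

  If r t = 1, then t maps the union of the A_i onto itself, so that union is zonal about the axis of t.
  Each circle about this axis through a point of A_2 is connected and contained in the union, hence
  in A_2, and therefore t maps A_2 into itself, not onto the disjoint set A_3.

  If g = r t is not 1, then g maps C_2 into itself, so C_2 is zonal about the axis a of g, while C_1 and
  C_3 are zonal about the images of a under the inverse of s and under t.  These axes differ from that of
  g, as otherwise C_1 or C_3 would be contained in C_2.  A boundary circle of C_2 about a lies in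
  C_1 \<union> C_3, so an arc of it lies in C_1, say; as the height over the other axis is not constant on
  the arc, the zone of C_1 swept out by the arc contains a point of C_2 in its interior, which is
  impossible since A_1 and A_2 are disjoint.
*)
theory Submission
  imports Defs
begin

section \<open>Free groups are torsion free\<close>

context group begin

section \<open>Words and their values in a group\<close>

lemma letter_value_closed: "snd l \<in> carrier G \<Longrightarrow> letter_value G l \<in> carrier G"
  by (cases l) auto

lemma word_value_closed: "snd ` set w \<subseteq> carrier G \<Longrightarrow> word_value G w \<in> carrier G"
  unfolding word_value_def
  by (induction w) (auto simp del: letter_value.simps intro!: letter_value_closed)

lemma word_value_Cons: "word_value G (l # w) = letter_value G l \<otimes> word_value G w"
  by (simp add: word_value_def)

lemma word_value_append:
  assumes "snd ` set v \<subseteq> carrier G" "snd ` set w \<subseteq> carrier G"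
  shows "word_value G (v @ w) = word_value G v \<otimes> word_value G w"
  using assms(1)
proof (induction v)
  case Nil
  then show ?case using word_value_closed[OF assms(2)] by (simp add: word_value_def)
next
  case (Cons l v)
  then show ?case
    using word_value_closed[OF assms(2)] word_value_closed[of v] letter_value_closed[of l]
    by (auto simp: word_value_Cons m_assoc simp del: letter_value.simps)
qed

lemma letter_value_cancel:
  assumes "snd l \<in> carrier G" "snd l = snd m" "fst l \<noteq> fst m"
  shows "letter_value G l \<otimes> letter_value G m = \<one>"
  using assms by (cases l; cases m) auto

lemma word_value_concat_replicate:
  assumes "snd ` set w \<subseteq> carrier G"
  shows "word_value G (concat (replicate n w)) = word_value G w [^] n"
proof (induction n)
  case 0
  then show ?case by (simp add: word_value_def)
next
  case (Suc n)
  have "snd ` set (concat (replicate n w)) \<subseteq> carrier G"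
    using assms by (fastforce simp: image_subset_iff)
  then show ?case
    using assms Suc word_value_closed[OF assms]
      nat_pow_Suc2[OF word_value_closed[OF assms], of n]
    by (simp add: word_value_append)
qed

lemma conj_pow:
  assumes "a \<in> carrier G" "x \<in> carrier G"
  shows "(a \<otimes> x \<otimes> inv a) [^] (n::nat) = a \<otimes> x [^] n \<otimes> inv a"
proof (induction n)
  case 0
  then show ?case using assms by simp
next
  case (Suc n)
  then show ?case using assms by (simp add: m_assoc inv_solve_left')
qed

lemma generate_word:
  assumes "S \<subseteq> carrier G" "x \<in> generate G S"
  shows "\<exists>w. snd ` set w \<subseteq> S \<and> word_value G w = x"
  using assms(2)
proof induction
  case one
  show ?case by (rule exI[of _ "[]"]) (simp add: word_value_def)
next
  case (incl h)
  then show ?case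
    using assms(1) by (intro exI[of _ "[(True, h)]"]) (auto simp: word_value_def)
next
  case (inv h)
  then show ?case
    using assms(1) by (intro exI[of _ "[(False, h)]"]) (auto simp: word_value_def)
next
  case (eng h1 h2)
  then obtain v w where "snd ` set v \<subseteq> S" "word_value G v = h1"
    "snd ` set w \<subseteq> S" "word_value G w = h2" by blast
  then show ?case
    using assms(1) by (intro exI[of _ "v @ w"]) (auto simp: word_value_append)
qed

text \<open>A word of least length among those with value \<open>x\<close> is reduced: deleting an
  adjacent pair of mutually inverse letters would leave a shorter word with the same value.\<close>

lemma generate_reduced_word:
  assumes S: "S \<subseteq> carrier G" and "x \<in> generate G S"
  obtains w where "snd ` set w \<subseteq> S" "word_value G w = x" "reduced_word w"
proof -
  let ?P = "\<lambda>w. snd ` set w \<subseteq> S \<and> word_value G w = x"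
  obtain w where w: "?P w" and least: "\<And>v. ?P v \<Longrightarrow> length w \<le> length v"
    using ex_has_least_nat[of ?P _ length] generate_word[OF assms] by blast
  have "reduced_word w"
  proof (rule ccontr)
    assume "\<not> reduced_word w"
    then obtain i where i: "Suc i < length w" "snd (w ! i) = snd (w ! Suc i)"
      "fst (w ! i) \<noteq> fst (w ! Suc i)"
      unfolding reduced_word_def successively_conv_nth by blast
    define u where "u = take i w"
    define v where "v = drop (Suc (Suc i)) w"
    have w_eq: "w = u @ [w ! i, w ! Suc i] @ v"
      using i(1) unfolding u_def v_def
      by (simp add: Cons_nth_drop_Suc)
    have mem: "snd ` set u \<subseteq> S" "snd ` set v \<subseteq> S" "snd (w ! i) \<in> S" "snd (w ! Suc i) \<in> S"
      using w i(1) w_eq by (auto simp: u_def v_def dest!: in_set_takeD in_set_dropD)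
    have cl: "letter_value G (w ! i) \<in> carrier G" "letter_value G (w ! Suc i) \<in> carrier G"
      "word_value G u \<in> carrier G" "word_value G v \<in> carrier G"
      using mem S by (auto intro!: letter_value_closed word_value_closed simp del: letter_value.simps)
    have "word_value G w = word_value G u \<otimes> word_value G (w ! i # w ! Suc i # v)"
      using mem S by (subst w_eq, subst word_value_append) auto
    also have "word_value G (w ! i # w ! Suc i # v)
        = (letter_value G (w ! i) \<otimes> letter_value G (w ! Suc i)) \<otimes> word_value G v"
      using cl by (simp add: word_value_Cons m_assoc)
    also have "\<dots> = word_value G v"
      using cl letter_value_cancel[of "w ! i" "w ! Suc i"] mem S i by auto
    finally have "word_value G (u @ v) = x"
      using mem S w by (subst word_value_append) auto
    then have "length w \<le> length (u @ v)"
      using mem by (intro least) auto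
    then show False
      using arg_cong[OF w_eq, of length] by simp
  qed
  then show thesis using that w by blast
qed

end

text \<open>The last assumption rules out cancellation where one copy of \<open>w\<close> ends and
  the next begins.\<close>

lemma reduced_word_concat_replicate:
  assumes "reduced_word w" "w \<noteq> []" "\<not> (snd (last w) = snd (hd w) \<and> fst (last w) \<noteq> fst (hd w))"
  shows "reduced_word (concat (replicate n w))"
proof (induction n)
  case 0
  then show ?case by (simp add: reduced_word_def)
next
  case (Suc n)
  have "hd (concat (replicate n w)) = hd w" if "n \<noteq> 0"
    using that assms(2) by (cases n) auto
  then show ?case
    using Suc assms by (cases "n = 0") (auto simp: reduced_word_def successively_append_iff)
qed

text \<open>Induction on the length. If the ends of \<open>w\<close> do not cancel, its power is the
  value of the repeated word, which is nonempty and reduced. Otherwise \<open>w\<close> consists of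
  a letter, a shorter word \<open>v\<close> and the inverse letter, so its value is conjugate to
  that of \<open>v\<close>.\<close>

lemma (in group) free_basis_reduced_word_pow:
  assumes fb: "free_basis G S" and n: "n > (0::nat)"
    and "snd ` set w \<subseteq> S" "reduced_word w" "w \<noteq> []"
  shows "word_value G w [^] n \<noteq> \<one>"
  using assms(3-)
proof (induction w rule: length_induct)
  case (1 w)
  have S: "S \<subseteq> carrier G" using fb by (simp add: free_basis_def)
  then have wS: "snd ` set w \<subseteq> carrier G" using 1(2) by blast
  show ?case
  proof (cases "snd (last w) = snd (hd w) \<and> fst (last w) \<noteq> fst (hd w)")
    case False
    have "reduced_word (concat (replicate n w))"
      using reduced_word_concat_replicate 1(3,4) False by blast
    moreover have "concat (replicate n w) \<noteq> []" using n 1(4) by (cases n) auto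
    moreover have "snd ` set (concat (replicate n w)) \<subseteq> S"
      using 1(2) by (fastforce simp: image_subset_iff)
    ultimately have "word_value G (concat (replicate n w)) \<noteq> \<one>"
      using fb unfolding free_basis_def by blast
    then show ?thesis
      using word_value_concat_replicate[OF wS] by simp
  next
    case True
    obtain l u where lu: "w = l # u" using 1(4) by (cases w) auto
    have "u \<noteq> []" using True lu by auto
    then obtain v m where vm: "w = l # v @ [m]" using lu by (cases u rule: rev_cases) auto
    have lm: "snd m = snd l" "fst m \<noteq> fst l" using True vm by auto
    \<comment> \<open>If \<open>v\<close> were empty, the cancelling letters \<open>l\<close> and
      \<open>m\<close> would be adjacent in the reduced word \<open>w\<close>.\<close>
    have "v \<noteq> []" using 1(3) vm lm by (auto simp: reduced_word_def)
    moreover have "reduced_word v"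
      using 1(3) vm by (auto simp: reduced_word_def successively_append_iff successively_Cons)
    ultimately have "word_value G v [^] n \<noteq> \<one>"
      using 1(1,2) vm by auto
    moreover have cl: "letter_value G l \<in> carrier G" "letter_value G m \<in> carrier G"
        "word_value G v \<in> carrier G"
      using wS vm word_value_closed[of v] letter_value_closed[of l] letter_value_closed[of m] by auto
    have "letter_value G m = inv (letter_value G l)"
      using letter_value_cancel[of m l] lm cl wS vm by (intro inv_equality[symmetric]) auto
    then have "word_value G w = letter_value G l \<otimes> word_value G v \<otimes> inv (letter_value G l)"
      using wS vm cl word_value_append[of v "[m]"]
      by (simp add: word_value_Cons m_assoc word_value_def del: letter_value.simps)
    \<comment> \<open>Conjugating back shows that a trivial power of the value of \<open>w\<close>
      would make the same power of the value of \<open>v\<close> trivial.\<close>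
    moreover have "word_value G v [^] n
        = inv (letter_value G l) \<otimes> (letter_value G l \<otimes> word_value G v [^] n \<otimes> inv (letter_value G l))
          \<otimes> letter_value G l"
      using cl by (simp add: m_assoc del: letter_value.simps) (simp flip: m_assoc del: letter_value.simps)
    ultimately show ?thesis
      using cl conj_pow[of "letter_value G l" "word_value G v" n]
      by (auto simp del: letter_value.simps)
  qed
qed

lemma free_group_torsion_free:
  assumes "free_group G" "x \<in> carrier G" "n > (0::nat)" "x [^]\<^bsub>G\<^esub> n = \<one>\<^bsub>G\<^esub>"
  shows "x = \<one>\<^bsub>G\<^esub>"
proof -
  interpret group G using assms(1) by (simp add: free_group_def)
  obtain S where S: "free_basis G S" using assms(1) by (auto simp: free_group_def)
  then obtain w where w: "snd ` set w \<subseteq> S" "word_value G w = x" "reduced_word w"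
    using generate_reduced_word[of S x] assms(2) by (auto simp: free_basis_def)
  then have "w = []"
    using free_basis_reduced_word_pow[OF S assms(3) w(1,3)] assms(4) by auto
  then show ?thesis using w(2) by (simp add: word_value_def)
qed

section \<open>Rotations about an axis\<close>

text \<open>Rodrigues' formula for the rotation by the angle \<phi> about a unit vector
  \<open>a\<close>. Heights over \<open>a\<close> and continuity in the angle can be read off from
  it more easily than from a matrix.\<close>

definition rot :: "real^3 \<Rightarrow> real \<Rightarrow> real^3 \<Rightarrow> real^3" where
  "rot a \<phi> x = (a \<bullet> x) *\<^sub>R a + cos \<phi> *\<^sub>R (x - (a \<bullet> x) *\<^sub>R a) + sin \<phi> *\<^sub>R cross3 a x"

lemma cross3_cross3_unit:
  assumes "norm a = 1"
  shows "cross3 a (cross3 a x) = (a \<bullet> x) *\<^sub>R a - x"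
  using assms by (simp add: Lagrange norm_eq_1)

lemma inner_rot_axis:
  assumes "norm a = 1"
  shows "a \<bullet> rot a \<phi> x = a \<bullet> x"
  using assms by (simp add: rot_def inner_add_right inner_diff_right dot_cross_self norm_eq_1)

lemma rot_0 [simp]: "rot a 0 x = x"
  by (simp add: rot_def)

lemma rot_add:
  assumes "norm a = 1"
  shows "rot a \<phi> (rot a \<psi> x) = rot a (\<phi> + \<psi>) x"
proof -
  have "cross3 a (x - (a \<bullet> x) *\<^sub>R a) = cross3 a x"
    by (simp add: Cross3.right_diff_distrib cross_mult_right)
  then have "cross3 a (c *\<^sub>R (x - (a \<bullet> x) *\<^sub>R a)) = c *\<^sub>R cross3 a x" for c
    by (simp only: cross_mult_right)
  \<comment> \<open>On the plane orthogonal to \<open>a\<close> the map \<open>cross3 a\<close> is a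
    quarter turn, so it exchanges the cosine and sine terms up to sign; the addition theorems then
    finish the proof.\<close>
  then have c: "cross3 a (rot a \<psi> x) = cos \<psi> *\<^sub>R cross3 a x - sin \<psi> *\<^sub>R (x - (a \<bullet> x) *\<^sub>R a)"
    using assms by (simp add: rot_def cross_add_right cross_mult_right
        cross3_cross3_unit flip: scaleR_diff_right)
       (simp add: scaleR_diff_right)
  show ?thesis
    unfolding rot_def[of a \<phi>] inner_rot_axis[OF assms] c
    unfolding rot_def cos_add sin_add
    by (simp add: algebra_simps)
qed

text \<open>The three summands of \<open>rot\<close> are pairwise orthogonal, and the component of
  \<open>x\<close> orthogonal to \<open>a\<close> is as long as \<open>cross3 a x\<close>, so the
  squared cosine and sine add up to 1.\<close>

lemma norm_rot:
  assumes "norm a = 1"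
  shows "norm (rot a \<phi> x) = norm x"
proof -
  have aa: "a \<bullet> a = 1" using assms by (simp add: norm_eq_1)
  have "cross3 a x \<bullet> cross3 a x = x \<bullet> x - (a \<bullet> x)^2"
    using norm_cross_dot[of a x] assms by (simp add: power2_norm_eq_inner power_mult_distrib algebra_simps)
  moreover have "rot a \<phi> x \<bullet> rot a \<phi> x = (a \<bullet> x)^2 + (cos \<phi>)^2 * (x \<bullet> x - (a \<bullet> x)^2)
     + (sin \<phi>)^2 * (cross3 a x \<bullet> cross3 a x)"
    by (simp add: rot_def inner_add_left inner_add_right inner_diff_left inner_diff_right aa
        dot_cross_self inner_commute[of x a] inner_commute[of "cross3 a x" a] inner_commute[of "cross3 a x" x] power2_eq_square algebra_simps)
  ultimately have "rot a \<phi> x \<bullet> rot a \<phi> x = (a \<bullet> x)^2 + ((cos \<phi>)^2 + (sin \<phi>)^2) * (x \<bullet> x - (a \<bullet> x)^2)"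
    by (simp only: distrib_right add.assoc)
  then show ?thesis by (simp add: norm_eq)
qed

lemma continuous_on_rot [continuous_intros]:
  fixes f :: "real \<Rightarrow> real"
  shows "continuous_on A f \<Longrightarrow> continuous_on A (\<lambda>t. rot a (f t) x)"
  unfolding rot_def
  by (intro continuous_intros continuous_on_cos continuous_on_sin)

lemma rot_cos_sin_cong: "cos \<phi> = cos \<psi> \<Longrightarrow> sin \<phi> = sin \<psi> \<Longrightarrow> rot a \<phi> x = rot a \<psi> x"
  by (simp add: rot_def)

lemma rot_shift_2pi: "rot a (\<phi> + 2 * pi * of_int k) x = rot a \<phi> x"
  by (rule rot_cos_sin_cong) (simp_all add: cos_add sin_add)

text \<open>The vectors \<open>p\<close> and q = \<open>cross3 a p\<close> are orthogonal, equally
  long and, for nonzero \<open>p\<close>, span the plane orthogonal to \<open>a\<close>. The factor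
  \<open>p \<bullet> p\<close> avoids a division. The proof evaluates the double cross product q x
  (w x q) in two ways.\<close>

lemma orthogonal_plane_expansion:
  assumes a: "norm a = 1" and p: "a \<bullet> p = 0" and w: "a \<bullet> w = 0"
  shows "(p \<bullet> p) *\<^sub>R w = (w \<bullet> p) *\<^sub>R p + (w \<bullet> cross3 a p) *\<^sub>R cross3 a p"
proof -
  let ?q = "cross3 a p"
  have "cross3 w ?q = (w \<bullet> p) *\<^sub>R a" using w by (simp add: Lagrange inner_commute)
  moreover have "cross3 ?q a = p"
    using cross3_cross3_unit[OF a, of p] p by (simp add: cross_skew[of ?q])
  ultimately have "(w \<bullet> p) *\<^sub>R p = (?q \<bullet> ?q) *\<^sub>R w - (?q \<bullet> w) *\<^sub>R ?q"
    by (metis Lagrange cross_mult_right)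
  moreover have "?q \<bullet> ?q = p \<bullet> p"
    using norm_cross_dot[of a p] a p by (simp add: power2_norm_eq_inner)
  ultimately show ?thesis by (simp add: inner_commute algebra_simps)
qed

text \<open>The equality case of the Cauchy-Schwarz inequality: the component of \<open>z\<close>
  orthogonal to \<open>a\<close> has squared length
  \<open>1 - (a \<bullet> z)\<^sup>2\<close>.\<close>

lemma unit_eq_pole:
  fixes a z :: "'a::real_inner"
  assumes "norm a = 1" "norm z = 1" "(a \<bullet> z)\<^sup>2 = 1"
  shows "z = a \<or> z = - a"
proof -
  have "(z - (a \<bullet> z) *\<^sub>R a) \<bullet> (z - (a \<bullet> z) *\<^sub>R a) = 0"
    using assms by (simp add: norm_eq_1 inner_diff_left inner_diff_right inner_commute[of z a] power2_eq_square)
  then have "z = (a \<bullet> z) *\<^sub>R a" by simp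
  moreover have "a \<bullet> z = 1 \<or> a \<bullet> z = -1" using assms(3) by (simp add: power2_eq_1_iff)
  ultimately show ?thesis by (metis scaleR_one scaleR_minus1_left)
qed

text \<open>Points of equal height have components \<open>p\<close> and \<open>w\<close> of the same
  length in the plane orthogonal to \<open>a\<close>. Divided by \<open>r\<close>, the inner
  products of \<open>w\<close> with \<open>p\<close> and \<open>q\<close> form a point of the unit
  circle, hence a cosine and a sine. The poles are treated apart because \<open>r\<close> vanishes
  there.\<close>

lemma rot_ex_same_height:
  assumes a: "norm a = 1" and x: "norm x = 1" and y: "norm y = 1" and h: "a \<bullet> x = a \<bullet> y"
  obtains \<phi> where "y = rot a \<phi> x"
proof (cases "(a \<bullet> x)^2 = 1")
  case True
  have "a \<bullet> a = 1" using a by (simp add: dot_square_norm)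
  moreover have "x = a \<or> x = - a" using unit_eq_pole[OF a x True] .
  moreover have "y = a \<or> y = - a" using unit_eq_pole[OF a y] True h by simp
  ultimately have "x = y" using h by (elim disjE) simp_all
  then show thesis using that[of 0] by simp
next
  case False
  have aa: "a \<bullet> a = 1" "x \<bullet> x = 1" "y \<bullet> y = 1" using a x y by (simp_all add: norm_eq_1)
  define p where "p = x - (a \<bullet> x) *\<^sub>R a"
  define q where "q = cross3 a x"
  define w where "w = y - (a \<bullet> y) *\<^sub>R a"
  define r where "r = 1 - (a \<bullet> x)^2"
  have pp: "p \<bullet> p = r" and ww: "w \<bullet> w = r" and "a \<bullet> p = 0" and aw: "a \<bullet> w = 0"
    by (auto simp: p_def w_def r_def aa h inner_diff_left inner_diff_right inner_commute[of x a] inner_commute[of y a] power2_eq_square)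
  have "r \<noteq> 0" using False by (simp add: r_def)
  have "cross3 a p = q" by (simp add: p_def q_def Cross3.right_diff_distrib cross_mult_right)
  then have rw: "r *\<^sub>R w = (w \<bullet> p) *\<^sub>R p + (w \<bullet> q) *\<^sub>R q"
    using orthogonal_plane_expansion[OF a \<open>a \<bullet> p = 0\<close> aw] pp by simp
  have "r * r = (r *\<^sub>R w) \<bullet> w" using ww by simp
  also have "\<dots> = (w \<bullet> p)^2 + (w \<bullet> q)^2"
    unfolding rw by (simp add: inner_add_left power2_eq_square inner_commute[of p w] inner_commute[of q w])
  finally have eq: "(w \<bullet> p)\<^sup>2 + (w \<bullet> q)\<^sup>2 = r * r" ..
  have "((w \<bullet> p) / r)\<^sup>2 + ((w \<bullet> q) / r)\<^sup>2 = ((w \<bullet> p)\<^sup>2 + (w \<bullet> q)\<^sup>2) / (r * r)"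
    by (simp add: power_divide add_divide_distrib power2_eq_square)
  also have "\<dots> = 1" unfolding eq using \<open>r \<noteq> 0\<close> by simp
  finally have "((w \<bullet> p) / r)\<^sup>2 + ((w \<bullet> q) / r)\<^sup>2 = 1" .
  then obtain \<phi> where \<phi>: "(w \<bullet> p) / r = cos \<phi>" "(w \<bullet> q) / r = sin \<phi>"
    by (metis sincos_total_2pi)
  have "w = (1 / r) *\<^sub>R (r *\<^sub>R w)" using \<open>r \<noteq> 0\<close> by simp
  also have "\<dots> = cos \<phi> *\<^sub>R p + sin \<phi> *\<^sub>R q"
    unfolding rw \<phi>[symmetric] by (simp add: scaleR_add_right)
  finally have "y = rot a \<phi> x"
    unfolding rot_def p_def[symmetric] q_def[symmetric] by (simp add: w_def h algebra_simps)
  then show thesis by (rule that)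
qed

section \<open>Rotation matrices and their axes\<close>

lemma rotation_matrix_inner:
  fixes g :: "real^'n^'n"
  assumes "rotation_matrix g"
  shows "(g *v x) \<bullet> (g *v y) = x \<bullet> y"
proof -
  have "transpose g *v (g *v x) = x"
    using assms unfolding rotation_matrix_def orthogonal_matrix_def matrix_vector_mul_assoc by simp
  moreover have "(g *v x) \<bullet> (g *v y) = (transpose g *v (g *v x)) \<bullet> y"
    by (simp only: dot_lmul_matrix transpose_matrix_vector)
  ultimately show ?thesis by simp
qed

lemma exists_orthogonal_unit:
  obtains u :: "real^3" where "norm u = 1" "a \<bullet> u = 0"
proof -
  obtain v where "v \<noteq> 0" "a \<bullet> v = 0"
    using orthogonal_to_vector_exists[of a] by (auto simp: orthogonal_def)
  then show thesis by (intro that[of "v /\<^sub>R norm v"]) auto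
qed

text \<open>The angle is read off from a unit vector \<open>u\<close> orthogonal to the axis. Both
  maps are linear and agree at \<open>a\<close>, \<open>u\<close> and \<open>cross3 a u\<close>, the
  last because rotation matrices preserve cross products.\<close>

lemma rotation_rot:
  assumes g: "rotation_matrix g" and a: "norm a = 1" and ga: "g *v a = a"
  obtains \<theta> where "\<And>x. g *v x = rot a \<theta> x"
proof -
  have aa: "a \<bullet> a = 1" using a by (simp add: norm_eq_1)
  note gi = rotation_matrix_inner[OF g]
  obtain u where u: "norm u = 1" "a \<bullet> u = 0" using exists_orthogonal_unit .
  have "norm (g *v u) = 1" "a \<bullet> u = a \<bullet> (g *v u)"
    using gi[of u u] gi[of a u] u ga by (auto simp: norm_eq_1)
  then obtain \<theta> where \<theta>: "g *v u = rot a \<theta> u"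
    using rot_ex_same_height a u(1) by metis
  let ?v = "cross3 a u"
  have v: "g *v ?v = rot a \<theta> ?v"
  proof -
    have "g *v ?v = cross3 (g *v a) (g *v u)" using cross_rotation_matrix[OF g] by simp
    also have "\<dots> = cross3 a (rot a \<theta> u)" by (simp add: ga \<theta>)
    also have "\<dots> = rot a \<theta> ?v"
      by (simp add: rot_def cross_add_right cross_mult_right Cross3.right_diff_distrib dot_cross_self)
    finally show ?thesis .
  qed
  have lin: "rot a \<theta> (x + y) = rot a \<theta> x + rot a \<theta> y" "rot a \<theta> (c *\<^sub>R x) = c *\<^sub>R rot a \<theta> x" for x y c
    by (simp_all add: rot_def inner_add_right cross_add_right cross_mult_right algebra_simps)
  show thesis
  proof (rule that[of \<theta>])
    fix x
    define w where "w = x - (a \<bullet> x) *\<^sub>R a"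
    have "a \<bullet> w = 0" by (simp add: w_def inner_diff_right aa)
    then have "w = (w \<bullet> u) *\<^sub>R u + (w \<bullet> ?v) *\<^sub>R ?v"
      using orthogonal_plane_expansion[OF a u(2)] u(1) by (simp add: norm_eq_1)
    then have x: "x = (a \<bullet> x) *\<^sub>R a + ((w \<bullet> u) *\<^sub>R u + (w \<bullet> ?v) *\<^sub>R ?v)" (is "x = ?E")
      by (simp add: w_def)
    have "rot a \<theta> a = a" by (simp add: rot_def aa)
    then have "g *v ?E = rot a \<theta> ?E"
      by (simp only: lin v \<theta> ga matrix_vector_right_distrib matrix_vector_mult_scaleR)
    then show "g *v x = rot a \<theta> x" unfolding x[symmetric] .
  qed
qed

text \<open>Since g - 1 = g (1 - g^T), the determinants of g - 1 and 1 - g coincide; in dimension 3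
  they are also negatives of each other, so both vanish and 1 is an eigenvalue.\<close>

lemma rotation_axis:
  assumes "rotation_matrix (g :: real^3^3)"
  obtains a where "norm a = 1" "g *v a = a"
proof -
  have g: "g ** transpose g = mat 1" "det g = 1"
    using assms by (auto simp: rotation_matrix_def orthogonal_matrix_def)
  have "g *v (transpose g *v x) = x" for x
    using g(1) by (simp add: matrix_vector_mul_assoc del: transpose_matrix_vector)
  then have "g - mat 1 = g ** (mat 1 - transpose g)"
    by (simp add: matrix_eq matrix_vector_mult_diff_rdistrib matrix_vector_mult_diff_distrib
        del: transpose_matrix_vector flip: matrix_vector_mul_assoc)
  then have "det (g - mat 1) = det (mat 1 - transpose g)"
    by (simp add: det_mul g)
  also have "mat 1 - transpose g = transpose (mat 1 - g)"
    by (simp add: vec_eq_iff transpose_def mat_def)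
  also have "det \<dots> = det (mat 1 - g)" by (rule det_transpose)
  also have "mat 1 - g = - (g - mat 1)" by simp
  also have "det (- (g - mat 1)) = - det (g - mat 1)" by (simp only: det_3 vector_uminus_component)
  finally have "det (g - mat 1) = 0" by simp
  then have "\<not> invertible (g - mat 1)" by (simp add: invertible_det_nz)
  then obtain v where v: "(g - mat 1) *v v = 0" "v \<noteq> 0"
    by (metis invertible_left_inverse matrix_left_invertible_ker)
  show thesis
  proof (rule that[of "v /\<^sub>R norm v"])
    show "norm (v /\<^sub>R norm v) = 1" using v by simp
    show "g *v (v /\<^sub>R norm v) = v /\<^sub>R norm v"
      using v by (simp add: matrix_vector_mult_scaleR matrix_vector_mult_diff_rdistrib)
  qed
qed

lemma rotation_inj:
  fixes h :: "real^'n^'n"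
  assumes "rotation_matrix h"
  shows "inj ((*v) h)"
  using assms unfolding rotation_matrix_def
  by (metis orthogonal_matrix_def inj_matrix_vector_mult invertible_def)

lemma rotation_closure_image:
  fixes h :: "real^'n^'n"
  assumes "rotation_matrix h"
  shows "(*v) h ` closure X = closure ((*v) h ` X)"
  using rotation_inj[OF assms] by (intro closure_injective_linear_image) simp_all

lemma rotation_norm:
  fixes h :: "real^'n^'n"
  assumes "rotation_matrix h"
  shows "norm (h *v x) = norm x"
  using rotation_matrix_inner[OF assms, of x x] by (simp add: norm_eq)

section \<open>Sets invariant under all rotations about an axis\<close>

text \<open>For a unit vector \<open>a\<close>, the subsets of the sphere with this property are the
  unions of circles of latitude about \<open>a\<close>, with the poles as degenerate
  circles.\<close>

definition zonal :: "real^3 \<Rightarrow> (real^3) set \<Rightarrow> bool" where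
  "zonal a C \<longleftrightarrow> (\<forall>x\<in>C. \<forall>\<phi>. rot a \<phi> x \<in> C)"

lemma zonalD: "zonal a C \<Longrightarrow> x \<in> C \<Longrightarrow> rot a \<phi> x \<in> C"
  by (simp add: zonal_def)

lemma zonal_diff:
  assumes "norm a = 1" "zonal a C"
  shows "zonal a (S2 - C)"
  unfolding zonal_def
proof (intro ballI allI DiffI)
  fix x \<phi> assume x: "x \<in> S2 - C"
  then show "rot a \<phi> x \<in> S2" using norm_rot[OF assms(1)] by simp
  have "rot a (-\<phi>) (rot a \<phi> x) = x" using rot_add[OF assms(1)] by simp
  then show "rot a \<phi> x \<notin> C" using zonalD[OF assms(2)] x by (metis DiffD2)
qed

lemma zonal_closure:
  assumes "zonal a C"
  shows "zonal a (closure C)"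
proof -
  have "continuous_on (closure C) (rot a \<phi>)" for \<phi>
    unfolding rot_def by (intro continuous_intros continuous_on_cross)
  then have "rot a \<phi> ` closure C \<subseteq> closure C" for \<phi>
    using assms by (intro image_closure_subset) (auto simp: zonal_def closure_subset[THEN subsetD])
  then show ?thesis by (auto simp: zonal_def)
qed

lemma zonal_same_height:
  assumes "norm a = 1" "zonal a C" "x \<in> C" "norm x = 1" "norm y = 1" "a \<bullet> x = a \<bullet> y"
  shows "y \<in> C"
  using rot_ex_same_height[OF assms(1,4,5,6)] zonalD[OF assms(2,3)] by metis

lemma rotation_rot_conj:
  assumes "rotation_matrix h"
  shows "h *v rot a \<phi> x = rot (h *v a) \<phi> (h *v x)"
  unfolding rot_def
  by (simp add: cross_rotation_matrix[OF assms] rotation_matrix_inner[OF assms]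
      matrix_vector_right_distrib matrix_vector_mult_diff_distrib matrix_vector_mult_scaleR)

lemma zonal_image:
  assumes "rotation_matrix h" "zonal a C"
  shows "zonal (h *v a) ((*v) h ` C)"
  using assms(2) by (auto simp: zonal_def rotation_rot_conj[OF assms(1), symmetric])

text \<open>Infinite order makes the angle of \<open>g\<close> an irrational multiple of 2 pi. The
  forward orbit of a point of \<open>C\<close> is then dense in its circle about \<open>a\<close>,
  and \<open>C\<close>, being closed, contains the whole circle.\<close>

lemma zonal_of_invariant:
  assumes g: "rotation_matrix g" and a: "norm a = 1" and ga: "g *v a = a"
    and inf: "\<And>n. n > 0 \<Longrightarrow> (*v) g ^^ n \<noteq> id"
    and C: "closed C" "(*v) g ` C \<subseteq> C"
  shows "zonal a C"
  unfolding zonal_def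
proof (intro ballI allI)
  fix x \<phi> assume x: "x \<in> C"
  obtain \<theta> where \<theta>: "\<And>x. g *v x = rot a \<theta> x" using rotation_rot[OF g a ga] by blast
  have pow: "((*v) g ^^ n) y = rot a (n * \<theta>) y" for n y
    by (induction n) (auto simp: \<theta> rot_add[OF a] algebra_simps)
  have powC: "((*v) g ^^ n) x \<in> C" for n
    using x C(2) by (induction n) auto
  have irr: "\<theta> / (2 * pi) \<notin> \<rat>"
  proof
    assume "\<theta> / (2 * pi) \<in> \<rat>"
    then obtain p :: int and q :: nat where "q \<noteq> 0" "\<theta> / (2 * pi) = p / q"
      unfolding Rats_eq_int_div_nat by auto
    then have "q * \<theta> = 0 + 2 * pi * of_int p" by (simp add: field_simps)
    then have "((*v) g ^^ q) y = y" for y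
      unfolding pow using rot_shift_2pi[of a 0 p y] by simp
    then show False using inf[of q] \<open>q \<noteq> 0\<close> by (auto simp: fun_eq_iff)
  qed
  show "rot a \<phi> x \<in> C"
  proof (rule ccontr)
    assume notin: "rot a \<phi> x \<notin> C"
    have "open ((\<lambda>\<psi>. rot a \<psi> x) -` (- C))"
      using C(1) by (intro open_vimage) (auto intro!: continuous_intros)
    then obtain e where e: "e > 0" "\<And>\<psi>. \<bar>\<psi> - \<phi>\<bar> < e \<Longrightarrow> rot a \<psi> x \<notin> C"
      using notin unfolding open_dist dist_real_def by auto
    \<comment> \<open>Kronecker's theorem supplies a multiple of the angle of \<open>g\<close> that
      is close to \<phi> modulo 2 pi. That \<open>k\<close> is positive matters, as only forward
      iterates of \<open>g\<close> are known to keep \<open>x\<close> in \<open>C\<close>.\<close>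
    then obtain h k where k: "k > 0"
      and hk: "\<bar>of_int k * (\<theta> / (2 * pi)) - of_int h - \<phi> / (2 * pi)\<bar> < e / (2 * pi)"
      using sequence_of_fractional_parts_is_dense[OF irr, of "e / (2 * pi)" "\<phi> / (2 * pi)"] e(1)
      by (metis divide_pos_pos pi_gt_zero zero_less_mult_iff zero_less_numeral)
    define \<psi> where "\<psi> = of_int k * \<theta> + 2 * pi * of_int (- h)"
    have eq: "\<psi> - \<phi> = 2 * pi * (of_int k * (\<theta> / (2 * pi)) - of_int h - \<phi> / (2 * pi))"
      by (simp add: \<psi>_def field_simps)
    have "\<bar>\<psi> - \<phi>\<bar> = 2 * pi * \<bar>of_int k * (\<theta> / (2 * pi)) - of_int h - \<phi> / (2 * pi)\<bar>"
      unfolding eq abs_mult by simp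
    also have "\<dots> < 2 * pi * (e / (2 * pi))"
      by (rule mult_strict_left_mono[OF hk]) simp
    finally have "\<bar>\<psi> - \<phi>\<bar> < e" by simp
    moreover have "rot a \<psi> x = ((*v) g ^^ nat k) x"
      unfolding \<psi>_def rot_shift_2pi pow using k by simp
    ultimately show False using e(2)[of \<psi>] powC[of "nat k"] by metis
  qed
qed

section \<open>Free groups of rotations acting on closed sets\<close>

lemma subgroup_SO3:
  assumes "subgroup F SO3"
  shows "g \<in> F \<Longrightarrow> rotation_matrix g" "mat 1 \<in> F" "g \<in> F \<Longrightarrow> h \<in> F \<Longrightarrow> g ** h \<in> F"
    "g \<in> F \<Longrightarrow> \<exists>h\<in>F. h ** g = mat 1 \<and> g ** h = mat 1"
proof -
  interpret SO3: group SO3 by (rule group_SO3)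
  show "g \<in> F \<Longrightarrow> rotation_matrix g"
    using subgroup.subset[OF assms] by (auto simp: SO3_def)
  show "mat 1 \<in> F" using subgroup.one_closed[OF assms] by (simp add: SO3_def)
  show "g \<in> F \<Longrightarrow> h \<in> F \<Longrightarrow> g ** h \<in> F"
    using subgroup.m_closed[OF assms] by (simp add: SO3_def)
  assume g: "g \<in> F"
  then have "g \<in> carrier SO3" using subgroup.subset[OF assms] by blast
  then have "inv\<^bsub>SO3\<^esub> g \<otimes>\<^bsub>SO3\<^esub> g = \<one>\<^bsub>SO3\<^esub>" "g \<otimes>\<^bsub>SO3\<^esub> inv\<^bsub>SO3\<^esub> g = \<one>\<^bsub>SO3\<^esub>"
    by auto
  then show "\<exists>h\<in>F. h ** g = mat 1 \<and> g ** h = mat 1"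
    using subgroup.m_inv_closed[OF assms g] by (intro bexI[of _ "inv\<^bsub>SO3\<^esub> g"]) (auto simp: SO3_def)
qed

text \<open>Torsion freeness of the abstract group, transferred to iterates of the map, which is the
  form that \<open>zonal_of_invariant\<close> asks for.\<close>

lemma free_rotations_infinite_order:
  assumes "free_group_of_rotations F" "g \<in> F" "g \<noteq> mat 1" "n > 0"
  shows "(*v) g ^^ n \<noteq> id"
proof
  let ?G = "SO3\<lparr>carrier := F\<rparr>"
  assume id: "(*v) g ^^ n = id"
  have "(g [^]\<^bsub>?G\<^esub> n) *v x = ((*v) g ^^ n) x" for n :: nat and x
    by (induction n arbitrary: x)
       (auto simp: SO3_def nat_pow_def funpow_swap1 simp flip: matrix_vector_mul_assoc)
  then have "g [^]\<^bsub>?G\<^esub> n = \<one>\<^bsub>?G\<^esub>"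
    using id by (simp add: matrix_eq SO3_def)
  then show False
    using free_group_torsion_free[of ?G g n] assms
    by (simp add: free_group_of_rotations_def SO3_def)
qed

lemma free_rotations_zonal:
  assumes F: "free_group_of_rotations F" and g: "g \<in> F" "g \<noteq> mat 1"
    and "norm a = 1" "g *v a = a" "closed C" "(*v) g ` C \<subseteq> C"
  shows "zonal a C"
  using assms(4-) subgroup_SO3(1)[of F g] F g free_rotations_infinite_order[OF F g]
  by (intro zonal_of_invariant) (auto simp: free_group_of_rotations_def)

text \<open>If \<open>h\<close> fixed \<open>a\<close>, it would be a rotation about
  \<open>a\<close> and preserve the zonal set \<open>C\<close>. If it reversed \<open>a\<close>, it
  would be a half turn about an axis orthogonal to \<open>a\<close>, contrary to torsion
  freeness.\<close>

lemma free_rotations_axis_moved: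
  assumes F: "free_group_of_rotations F" and h: "h \<in> F" and a: "norm a = 1"
    and "zonal a C" "\<not> (*v) h ` C \<subseteq> C"
  shows "h *v a \<noteq> a" "h *v a \<noteq> - a"
proof -
  have rh: "rotation_matrix h"
    using subgroup_SO3(1) F h by (auto simp: free_group_of_rotations_def)
  show "h *v a \<noteq> a"
  proof
    assume "h *v a = a"
    then obtain \<theta> where "\<And>x. h *v x = rot a \<theta> x" using rotation_rot[OF rh a] by blast
    then show False using assms(4,5) by (auto simp: zonal_def)
  qed
  show "h *v a \<noteq> - a"
  proof
    assume ha: "h *v a = - a"
    obtain t where t: "norm t = 1" "h *v t = t" using rotation_axis[OF rh] .
    obtain \<theta> where \<theta>: "\<And>x. h *v x = rot t \<theta> x" using rotation_rot[OF rh t] by blast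
    \<comment> \<open>Inner products are preserved, so that of \<open>t\<close> and \<open>a\<close>
      equals its own negative.\<close>
    have "t \<bullet> a = 0" using rotation_matrix_inner[OF rh, of t a] by (simp add: t ha)
    then have eq: "- a = cos \<theta> *\<^sub>R a + sin \<theta> *\<^sub>R cross3 t a"
      using \<theta>[of a] ha by (simp add: rot_def)
    then have "(- a) \<bullet> a = cos \<theta>"
      using a by (simp add: inner_add_left dot_cross_self norm_eq_1)
    then have c: "cos \<theta> = -1" using a by (simp add: norm_eq_1)
    then have s: "sin \<theta> = 0" using sin_cos_squared_add[of \<theta>] by simp
    have "rot t (\<theta> + \<theta>) x = rot t 0 x" for x
      by (rule rot_cos_sin_cong; unfold cos_add sin_add c s) simp_all
    then have "((*v) h ^^ 2) x = x" for x
      by (simp only: \<theta> rot_add[OF t(1)] numeral_2_eq_2 funpow.simps comp_apply id_apply rot_0)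
    moreover have "h \<noteq> mat 1" using assms(5) by auto
    ultimately show False
      using free_rotations_infinite_order[OF F h, of 2] by (auto simp: fun_eq_iff)
  qed
qed

section \<open>Circles and zones on the sphere\<close>

lemma sphere_openin_infinite:
  assumes "openin (top_of_set S2) U" "U \<noteq> {}"
  shows "infinite U"
proof -
  obtain O' where O': "open O'" "U = S2 \<inter> O'" using assms(1) by (auto simp: openin_open)
  obtain x where x: "x \<in> U" using assms(2) by blast
  \<comment> \<open>A connected set with more than one point has no isolated points, so
    \<open>x\<close> is an accumulation point of the sphere.\<close>
  have "connected S2" by (simp add: connected_sphere)
  moreover have "\<nexists>a. S2 = {a::real^3}"
  proof
    assume "\<exists>a::real^3. S2 = {a}"
    then obtain a :: "real^3" where a: "S2 = {a}" by blast
    then have n: "norm a = 1" by auto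
    then have "- a \<in> S2" by simp
    then have "- a = a" using a by blast
    then have "2 *\<^sub>R a = 0" unfolding scaleR_2 by (metis add.right_inverse)
    then show False using n by simp
  qed
  ultimately have "x islimpt S2"
    using connected_imp_perfect x O' by blast
  then show ?thesis
    using O' x by (auto simp: islimpt_eq_acc_point Int_commute)
qed

lemma unit_inner_bounds:
  fixes a z :: "'a::real_inner"
  assumes "norm a = 1" "norm z = 1"
  shows "(a \<bullet> z)\<^sup>2 \<le> 1"
  using Cauchy_Schwarz_ineq[of a z] assms by (simp add: norm_eq_1)

text \<open>An infinite set has a point off the two poles. This gives heights strictly between -1
  and 1, where circles do not degenerate.\<close>

lemma openin_sphere_nonpolar:
  assumes "openin (top_of_set S2) U" "U \<noteq> {}" "norm a = 1"
  obtains x where "x \<in> U" "(a \<bullet> x)\<^sup>2 < 1"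
proof -
  have "\<not> U \<subseteq> {a, - a}"
    using sphere_openin_infinite[OF assms(1,2)] by (meson finite.simps finite_subset)
  then obtain x where x: "x \<in> U" "x \<noteq> a" "x \<noteq> - a" by blast
  then have "norm x = 1" using openin_imp_subset[OF assms(1)] by auto
  then have "(a \<bullet> x)\<^sup>2 < 1"
    using unit_eq_pole[OF assms(3), of x] unit_inner_bounds[OF assms(3), of x] x by force
  then show thesis using that x by blast
qed

text \<open>The heights over \<open>a\<close> attained on \<open>C\<close> and on \<open>P\<close>
  form closed sets that cover the interval (-1, 1) and both meet it. As the interval is connected,
  some height in it is common to both; a point of \<open>C\<close> at this height lies in
  \<open>P\<close> since \<open>P\<close> is zonal.\<close>

lemma zonal_cover_common_circle:
  assumes a: "norm a = 1" and C: "closed C" "C \<subseteq> S2"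
    and P: "closed P" "P \<subseteq> S2" "zonal a P" and cover: "S2 \<subseteq> C \<union> P"
    and p: "p \<in> C" "(a \<bullet> p)\<^sup>2 < 1" and q: "q \<in> P" "(a \<bullet> q)\<^sup>2 < 1"
  obtains x where "x \<in> C" "x \<in> P" "(a \<bullet> x)\<^sup>2 < 1"
proof -
  have cl: "closed ((\<bullet>) a ` X)" if "closed X" "X \<subseteq> S2" for X
  proof -
    have "compact X" using that compact_sphere[of 0 1] by (metis closed_Int_compact inf.absorb1)
    then show ?thesis by (intro compact_imp_closed compact_continuous_image continuous_intros)
  qed
  obtain u where u: "norm u = 1" "a \<bullet> u = 0" using exists_orthogonal_unit .
  have cov: "{-1<..<1} \<subseteq> (\<bullet>) a ` C \<union> (\<bullet>) a ` P"
  proof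
    fix s :: real assume "s \<in> {-1<..<1}"
    then have s: "s\<^sup>2 \<le> 1" by (auto simp: abs_square_le_1 abs_le_iff)
    \<comment> \<open>The point of height \<open>s\<close> on the meridian through
      \<open>u\<close>.\<close>
    define y where "y = s *\<^sub>R a + sqrt (1 - s\<^sup>2) *\<^sub>R u"
    have "y \<bullet> y = 1" "a \<bullet> y = s"
      using u a s by (simp_all add: y_def norm_eq_1 inner_add_left inner_add_right inner_commute[of u a]
          power2_eq_square)
    then have "y \<in> S2" by (simp add: norm_eq_1)
    then show "s \<in> (\<bullet>) a ` C \<union> (\<bullet>) a ` P" using cover \<open>a \<bullet> y = s\<close> by blast
  qed
  have I: "s \<in> {-1<..<1}" if "s\<^sup>2 < 1" for s :: real
    using that by (auto simp: abs_square_less_1 abs_less_iff)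
  have "(\<bullet>) a ` C \<inter> (\<bullet>) a ` P \<inter> {-1<..<1} \<noteq> {}"
  proof
    assume "(\<bullet>) a ` C \<inter> (\<bullet>) a ` P \<inter> {-1<..<1} = {}"
    then have "(\<bullet>) a ` C \<inter> {-1<..<1} = {} \<or> (\<bullet>) a ` P \<inter> {-1<..<1} = {}"
      using connected_closedD[OF _ _ cov] cl C P by (simp add: connected_Ioo)
    then show False using p q I by blast
  qed
  then obtain s where "s \<in> (\<bullet>) a ` C" "s \<in> (\<bullet>) a ` P" "s \<in> {-1<..<1}" by blast
  then obtain x y where xy: "x \<in> C" "y \<in> P" "a \<bullet> x = a \<bullet> y" "a \<bullet> x \<in> {-1<..<1}" by auto
  then have "x \<in> P"
    using zonal_same_height[OF a P(3) xy(2), of x] xy C(2) P(2) by (metis dist_0_norm mem_sphere subsetD)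
  moreover have "(a \<bullet> x)\<^sup>2 < 1" using xy(4) by (auto simp: abs_square_less_1 abs_less_iff)
  ultimately show thesis using that xy(1) by blast
qed

text \<open>The height over the second axis \<open>b\<close> is not constant on the arc, so by
  connectedness it takes all values of some interval. As \<open>C\<close> is zonal about
  \<open>b\<close>, it contains the open zone of the sphere with heights in that interval.\<close>

lemma zonal_arc_interior:
  assumes a: "norm a = 1" and b: "norm b = 1" "b \<noteq> a" "b \<noteq> - a"
    and C: "C \<subseteq> S2" "zonal b C" and x: "norm x = 1" "(a \<bullet> x)\<^sup>2 < 1"
    and lu: "l < u" "\<And>\<phi>. \<phi> \<in> {l<..<u} \<Longrightarrow> rot a \<phi> x \<in> C"
  obtains \<phi> V where "open V" "rot a \<phi> x \<in> V" "V \<inter> S2 \<subseteq> C"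
proof -
  define f where "f \<phi> = b \<bullet> rot a \<phi> x" for \<phi>
  \<comment> \<open>In the angle measured from the midpoint \<open>m\<close>, \<open>f\<close> is a
    constant plus multiples of cosine and sine. If it were constant on the interval, its values at m
    - t, m and m + t would force both multiples to vanish; then \<open>b\<close> would be orthogonal
    to the plane of the circle, hence equal to \<open>a\<close> or its negative.\<close>
  have "\<exists>v\<in>{l<..<u}. \<exists>w\<in>{l<..<u}. f v \<noteq> f w"
  proof (rule ccontr)
    assume const: "\<not> ?thesis"
    define m where "m = (l + u) / 2"
    \<comment> \<open>The bound 1 is less than pi, which gives sin t > 0 and cos t < 1; the other
      bound keeps m - t and m + t inside the interval.\<close>
    define t where "t = min 1 ((u - l) / 4)"
    have t: "0 < t" "t \<le> 1" using lu by (auto simp: t_def)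
    have mt: "m + t \<in> {l<..<u}" "m - t \<in> {l<..<u}" "m \<in> {l<..<u}"
      using lu(1) by (auto simp: m_def t_def min_def field_simps)
    define x' where "x' = rot a m x"
    define p where "p = x' - (a \<bullet> x') *\<^sub>R a"
    have x': "a \<bullet> x' = a \<bullet> x" "norm x' = 1" using inner_rot_axis norm_rot a x by (auto simp: x'_def)
    have ap: "a \<bullet> p = 0" using a by (simp add: p_def inner_diff_right norm_eq_1)
    have "p \<bullet> p = 1 - (a \<bullet> x)\<^sup>2"
      using a x' unfolding p_def
      by (simp add: norm_eq_1 inner_diff_left inner_diff_right inner_commute[of x' a] power2_eq_square)
    then have pp: "p \<bullet> p \<noteq> 0" using x by simp
    have f: "f (m + s) = (a \<bullet> x') * (b \<bullet> a) + cos s * (b \<bullet> p) + sin s * (b \<bullet> cross3 a x')" for s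
    proof -
      have "rot a (m + s) x = rot a s x'" by (simp add: x'_def rot_add[OF a] add.commute)
      also have "\<dots> = (a \<bullet> x') *\<^sub>R a + cos s *\<^sub>R p + sin s *\<^sub>R cross3 a x'"
        by (simp add: rot_def p_def)
      finally show ?thesis by (simp add: f_def inner_add_right)
    qed
    have "f (m + t) = f m" "f (m - t) = f m" using const mt by blast+
    then have "cos t * (b \<bullet> p) + sin t * (b \<bullet> cross3 a x') = b \<bullet> p"
      "cos t * (b \<bullet> p) - sin t * (b \<bullet> cross3 a x') = b \<bullet> p"
      using f[of t] f[of "-t"] f[of 0] by simp_all
    then have "sin t * (b \<bullet> cross3 a x') = 0" "(1 - cos t) * (b \<bullet> p) = 0" by (auto simp: algebra_simps)
    moreover have "sin t > 0" using t pi_gt3 by (intro sin_gt_zero) auto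
    moreover have "cos t < 1" using t pi_gt3 cos_monotone_0_pi[of 0 t] by simp
    ultimately have "b \<bullet> p = 0" "b \<bullet> cross3 a x' = 0" by auto
    moreover have "cross3 a p = cross3 a x'" by (simp add: p_def Cross3.right_diff_distrib cross_mult_right)
    moreover define w where "w = b - (a \<bullet> b) *\<^sub>R a"
    moreover have "a \<bullet> w = 0" using a by (simp add: w_def inner_diff_right norm_eq_1)
    moreover have "a \<bullet> cross3 a p = 0" by (simp add: dot_cross_self)
    ultimately have "w = 0"
      using orthogonal_plane_expansion[OF a ap, of w] ap pp by (simp add: inner_diff_left)
    then have "b \<bullet> b = ((a \<bullet> b) *\<^sub>R a) \<bullet> b" by (simp add: w_def)
    then have "(a \<bullet> b)\<^sup>2 = 1" using b(1) by (simp add: norm_eq_1 power2_eq_square)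
    then show False using unit_eq_pole[OF a b(1)] b by blast
  qed
  then obtain v w where vw: "v \<in> {l<..<u}" "w \<in> {l<..<u}" "f v < f w"
    by (metis linorder_neqE_linordered_idom)
  have "connected (f ` {l<..<u})"
    unfolding f_def by (intro connected_continuous_image continuous_intros connected_Ioo)
  then have img: "{f v..f w} \<subseteq> f ` {l<..<u}"
    using vw connected_contains_Icc by blast
  define V where "V = {y. f v < b \<bullet> y \<and> b \<bullet> y < f w}"
  have "(f v + f w) / 2 \<in> f ` {l<..<u}" using img vw(3) by (auto simp: subset_iff)
  then obtain \<phi> where "f \<phi> = (f v + f w) / 2" by auto
  then have "rot a \<phi> x \<in> V" using vw(3) by (simp add: V_def f_def[of \<phi>, symmetric] field_simps)
  moreover have "open V"
    unfolding V_def by (intro open_Collect_conj open_Collect_less continuous_intros)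
  moreover have "V \<inter> S2 \<subseteq> C"
  proof
    fix y assume y: "y \<in> V \<inter> S2"
    then have "b \<bullet> y \<in> f ` {l<..<u}" using img by (auto simp: V_def subset_iff)
    then obtain \<psi> where "\<psi> \<in> {l<..<u}" "b \<bullet> rot a \<psi> x = b \<bullet> y" by (auto simp: f_def)
    then show "y \<in> C"
      using zonal_same_height[OF b(1) C(2) lu(2), of \<psi> y] y norm_rot[OF a] x by auto
  qed
  ultimately show thesis using that by blast
qed

text \<open>If the circle leaves the closed set \<open>C\<close> at some angle, it does so on an
  open interval of angles, and there it must lie in \<open>D\<close>.\<close>

lemma rot_arc_in_one_of_two:
  assumes "closed C" "\<And>\<phi>. rot a \<phi> x \<in> C \<union> D"
  obtains l u where "l < u" "(\<forall>\<phi>\<in>{l<..<u}. rot a \<phi> x \<in> C) \<or> (\<forall>\<phi>\<in>{l<..<u}. rot a \<phi> x \<in> D)"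
proof (cases "\<forall>\<phi>. rot a \<phi> x \<in> C")
  case True
  then show thesis using that[of 0 1] by auto
next
  case False
  then obtain \<phi> where \<phi>: "rot a \<phi> x \<notin> C" by blast
  have "open ((\<lambda>\<psi>. rot a \<psi> x) -` (- C))"
    using assms(1) by (intro open_vimage) (auto intro!: continuous_intros)
  then obtain e where "e > 0" "\<And>\<psi>. \<bar>\<psi> - \<phi>\<bar> < e \<Longrightarrow> rot a \<psi> x \<notin> C"
    using \<phi> unfolding open_dist dist_real_def by auto
  moreover have "rot a \<psi> x \<in> D" if "\<psi> \<in> {\<phi> - e<..<\<phi> + e}" for \<psi>
  proof -
    have "\<bar>\<psi> - \<phi>\<bar> < e" using that by (auto simp: abs_less_iff)
    then show ?thesis using calculation(2) assms(2)[of \<psi>] by blast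
  qed
  ultimately show thesis using that[of "\<phi> - e" "\<phi> + e"] by auto
qed

section \<open>The congruences\<close>

theorem theorem5p1:
  shows "\<not> (\<exists>(A\<^sub>1 :: (real^3) set) (A\<^sub>2 :: (real^3) set) (A\<^sub>3 :: (real^3) set) (F :: (real^3^3) set).
            openin (top_of_set S2) A\<^sub>1 \<and> openin (top_of_set S2) A\<^sub>2 \<and> openin (top_of_set S2) A\<^sub>3 \<and>
            A\<^sub>1 \<inter> A\<^sub>2 = {} \<and> A\<^sub>1 \<inter> A\<^sub>3 = {} \<and> A\<^sub>2 \<inter> A\<^sub>3 = {} \<and>
            top_of_set S2 closure_of (A\<^sub>1 \<union> A\<^sub>2 \<union> A\<^sub>3) = S2 \<and>
            free_group_of_rotations F \<and>
            (\<exists>g\<in>F. witnesses_congruence g A\<^sub>1 A\<^sub>2) \<and>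
            (\<exists>g\<in>F. witnesses_congruence g A\<^sub>2 A\<^sub>3) \<and>
            (\<exists>g\<in>F. witnesses_congruence g (A\<^sub>1 \<union> A\<^sub>2) (A\<^sub>1 \<union> A\<^sub>3)))"
proof (intro notI, elim exE conjE bexE)
  fix A1 A2 A3 :: "(real^3) set" and F and s t r :: "real^3^3"
  assume op: "openin (top_of_set S2) A1" "openin (top_of_set S2) A2" "openin (top_of_set S2) A3"
    and disj: "A1 \<inter> A2 = {}" "A1 \<inter> A3 = {}" "A2 \<inter> A3 = {}"
    and dense: "top_of_set S2 closure_of (A1 \<union> A2 \<union> A3) = S2"
    and F: "free_group_of_rotations F"
    and mem: "s \<in> F" "t \<in> F" "r \<in> F"
    and "witnesses_congruence s A1 A2" "witnesses_congruence t A2 A3"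
      "witnesses_congruence r (A1 \<union> A2) (A1 \<union> A3)"
  then have sA: "(*v) s ` A1 = A2" and tA: "(*v) t ` A2 = A3"
    and rA: "(*v) r ` (A1 \<union> A2) = A1 \<union> A3"
    by (simp_all add: witnesses_congruence_def)
  have subF: "subgroup F SO3" using F by (simp add: free_group_of_rotations_def)
  note rot = subgroup_SO3(1)[OF subF]
  have sub: "A1 \<subseteq> S2" "A2 \<subseteq> S2" "A3 \<subseteq> S2" using op openin_imp_subset by blast+
  define C1 C2 C3 where "C1 = closure A1" and "C2 = closure A2" and "C3 = closure A3"
  have C_sub: "C1 \<subseteq> S2" "C2 \<subseteq> S2" "C3 \<subseteq> S2"
    unfolding C1_def C2_def C3_def using sub by (simp_all add: closure_minimal)
  have A_sub: "A1 \<subseteq> C1" "A2 \<subseteq> C2" "A3 \<subseteq> C3"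
    unfolding C1_def C2_def C3_def by (rule closure_subset)+
  \<comment> \<open>Density is stated in the subspace topology. Since the union lies in the sphere,
    this becomes a statement on its closure in space, which is the union of the three
    closures.\<close>
  have "S2 \<inter> (A1 \<union> A2 \<union> A3) = A1 \<union> A2 \<union> A3" using sub by blast
  then have "S2 \<inter> closure (A1 \<union> A2 \<union> A3) = S2"
    using dense by (simp only: closure_of_subtopology euclidean_closure_of)
  then have cover: "S2 \<subseteq> C1 \<union> C2 \<union> C3"
    unfolding C1_def C2_def C3_def closure_Un by blast
  have ne: "A2 \<noteq> {}"
  proof
    assume "A2 = {}"
    then have "A1 = {}" "A3 = {}" using sA tA by auto
    then have "S2 = {}" using dense \<open>A2 = {}\<close> by simp
    then show False by simp
  qed
  then have ne1: "A1 \<noteq> {}" using sA by auto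
  have ne3: "A3 \<noteq> {}" using ne tA by auto
  \<comment> \<open>A relatively open set that misses \<open>X\<close> also misses its closure; this
    will separate the A_i from the closures of the others.\<close>
  have sep: "U \<inter> closure X = {}" if U: "openin (top_of_set S2) U" "U \<inter> X = {}" "X \<subseteq> S2" for U X
  proof -
    obtain V where V: "open V" "U = S2 \<inter> V" using U(1) by (auto simp: openin_open)
    then have "V \<inter> X = {}" using U by blast
    then show ?thesis using open_Int_closure_eq_empty[OF V(1), of X] V(2) by blast
  qed
  have inv: "\<exists>h'\<in>F. h' ** h = mat 1 \<and> h ** h' = mat 1" if "h \<in> F" for h
    using subgroup_SO3(4)[OF subF that] .
  define g where "g = r ** t"
  have gF: "g \<in> F" unfolding g_def using subgroup_SO3(3)[OF subF] mem by blast
  obtain s' where s': "s' \<in> F" "s' ** s = mat 1" "s ** s' = mat 1" using inv mem by blast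
  show False
  proof (cases "g = mat 1")
    case True
    then have tr: "t ** r = mat 1" by (simp add: g_def matrix_left_right_inverse)
    \<comment> \<open>Here \<open>r\<close> is inverse to \<open>t\<close>, so \<open>t\<close> maps
      A1 \<union> A3 onto A1 \<union> A2. Together with the image A3 of A2 this gives back the union
      of all three sets.\<close>
    have "(*v) t ` (A1 \<union> A3) = (*v) (t ** r) ` (A1 \<union> A2)"
      by (simp add: rA[symmetric] image_image matrix_vector_mul_assoc)
    then have tE: "(*v) t ` (A1 \<union> A2 \<union> A3) = A1 \<union> A2 \<union> A3"
      using tA by (auto simp: tr image_Un)
    \<comment> \<open>The union is open, so invariance is passed to its complement in the sphere, a
      closed set to which \<open>free_rotations_zonal\<close> applies.\<close>
    define D where "D = S2 - (A1 \<union> A2 \<union> A3)"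
    have "openin (top_of_set S2) (A1 \<union> A2 \<union> A3)" by (intro openin_Un op)
    from closedin_diff[OF closedin_topspace this] have D: "closed D"
      by (simp add: D_def closedin_closed_trans)
    have "(*v) t ` D \<subseteq> D"
    proof
      fix y assume "y \<in> (*v) t ` D"
      then obtain x where x: "x \<in> D" "y = t *v x" by blast
      have "inj ((*v) t)" using rotation_inj rot mem by blast
      then have "y \<notin> A1 \<union> A2 \<union> A3" using x tE by (metis D_def DiffD2 inj_image_mem_iff)
      then show "y \<in> D" using x rotation_norm[OF rot[OF mem(2)]] by (simp add: D_def)
    qed
    obtain a where a: "norm a = 1" "t *v a = a" using rotation_axis[OF rot[OF mem(2)]] .
    have "t \<noteq> mat 1" using tA ne disj by auto
    then have "zonal a D"
      using free_rotations_zonal[OF F mem(2) _ a D] \<open>(*v) t ` D \<subseteq> D\<close> by blast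
    obtain \<theta> where \<theta>: "\<And>x. t *v x = rot a \<theta> x" using rotation_rot[OF rot[OF mem(2)] a] by blast
    obtain x where x: "x \<in> A2" using ne by blast
    \<comment> \<open>This circle about the axis of \<open>t\<close> contains \<open>x\<close> in A2
      and its image in A3, although it is connected and covered by the disjoint relatively open sets
      A2 and A1 \<union> A3.\<close>
    define Z where "Z = range (\<lambda>\<phi>. rot a \<phi> x)"
    have "connected Z"
      unfolding Z_def by (intro connected_continuous_image continuous_intros connected_UNIV)
    have "zonal a (A1 \<union> A2 \<union> A3)"
    proof -
      have "S2 - D = A1 \<union> A2 \<union> A3" using sub by (auto simp: D_def)
      then show ?thesis using zonal_diff[OF a(1) \<open>zonal a D\<close>] by simp
    qed
    then have ZE: "Z \<subseteq> A2 \<union> (A1 \<union> A3)" using x by (auto simp: Z_def zonal_def)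
    have "openin (top_of_set S2) (A1 \<union> A3)" by (intro openin_Un op)
    then obtain V W where VW: "open V" "A2 = S2 \<inter> V" "open W" "A1 \<union> A3 = S2 \<inter> W"
      using op(2) unfolding openin_open by blast
    have "Z \<subseteq> V \<union> W" using ZE VW by blast
    moreover have "V \<inter> W \<inter> Z = {}" using ZE VW disj sub by blast
    ultimately have "V \<inter> Z = {} \<or> W \<inter> Z = {}" by (intro connectedD[OF \<open>connected Z\<close> VW(1,3)])
    then have "Z \<inter> A2 = {} \<or> Z \<inter> (A1 \<union> A3) = {}" using VW by blast
    moreover have "x \<in> Z" unfolding Z_def by (rule range_eqI[of _ _ 0]) simp
    moreover have "t *v x \<in> Z" by (simp add: Z_def \<theta>)
    ultimately show False using x tA disj by blast
  next
    case False
    have tC: "(*v) t ` C2 = C3"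
      unfolding C2_def C3_def using rotation_closure_image[OF rot[OF mem(2)]] tA by metis
    have sC: "(*v) s ` C1 = C2"
      unfolding C2_def C1_def using rotation_closure_image[OF rot[OF mem(1)]] sA by metis
    have s'C: "(*v) s' ` C2 = C1"
      unfolding sC[symmetric] by (simp add: image_image matrix_vector_mul_assoc s')
    \<comment> \<open>The injective map \<open>r\<close> takes C1 \<union> C2 onto C1 \<union> C3,
      and A3 misses C1 \<union> C2. So the image of A3 misses C1 \<union> C3, and the covering of
      the sphere leaves only C2.\<close>
    have "(*v) r ` A3 \<subseteq> C2"
    proof
      fix y assume "y \<in> (*v) r ` A3"
      then obtain z where z: "z \<in> A3" "y = r *v z" by blast
      have "y \<in> S2" using z sub rotation_norm[OF rot[OF mem(3)]] by auto
      moreover have "y \<notin> C1 \<union> C3"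
      proof
        assume "y \<in> C1 \<union> C3"
        moreover have "(*v) r ` closure (A1 \<union> A2) = C1 \<union> C3"
          by (simp only: rotation_closure_image[OF rot[OF mem(3)]] rA) (simp add: C1_def C3_def)
        ultimately have "r *v z \<in> (*v) r ` closure (A1 \<union> A2)" using z by simp
        moreover have "inj ((*v) r)" using rotation_inj rot mem by blast
        ultimately have "z \<in> closure (A1 \<union> A2)" by (simp add: inj_image_mem_iff)
        then show False using sep[OF op(3), of "A1 \<union> A2"] z disj sub by blast
      qed
      ultimately show "y \<in> C2" using cover by blast
    qed
    then have "closure ((*v) r ` A3) \<subseteq> C2"
      by (intro closure_minimal) (auto simp: C2_def)
    then have "(*v) r ` C3 \<subseteq> C2"
      unfolding C3_def rotation_closure_image[OF rot[OF mem(3)]] .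
    then have gC: "(*v) g ` C2 \<subseteq> C2"
      using tC by (auto simp: g_def simp flip: matrix_vector_mul_assoc)
    obtain a where a: "norm a = 1" "g *v a = a" using rotation_axis[OF rot[OF gF]] .
    have z2: "zonal a C2"
      using free_rotations_zonal[OF F gF False a _ gC] by (simp add: C2_def)
    have z1: "zonal (s' *v a) C1" using zonal_image[OF rot[OF s'(1)] z2] s'C by simp
    have z3: "zonal (t *v a) C3" using zonal_image[OF rot[OF mem(2)] z2] tC by simp
    have disjC: "A1 \<inter> C2 = {}" "A3 \<inter> C2 = {}" "A2 \<inter> C1 = {}" "A2 \<inter> C3 = {}"
      unfolding C1_def C2_def C3_def using sep op disj sub by (metis Int_commute)+
    \<comment> \<open>C1 is the image of C2 under \<open>s'\<close> and contains the nonempty set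
      A1, which misses C2; hence it is not contained in C2 and the axis is moved. The same argument
      with A3 serves for \<open>t\<close>.\<close>
    have b: "s' *v a \<noteq> a" "s' *v a \<noteq> - a"
      using free_rotations_axis_moved[OF F s'(1) a(1) z2] s'C A_sub ne1 disjC by blast+
    have c: "t *v a \<noteq> a" "t *v a \<noteq> - a"
      using free_rotations_axis_moved[OF F mem(2) a(1) z2] tC A_sub ne3 disjC by blast+
    have nb: "norm (s' *v a) = 1" and nc: "norm (t *v a) = 1"
      using rotation_norm[OF rot] s'(1) mem(2) a by simp_all
    \<comment> \<open>\<open>P\<close> meets C2 exactly in the boundary of C2 relative to the
      sphere. As it is zonal about \<open>a\<close> and contained in C1 \<union> C3, the circle
      about \<open>a\<close> through a boundary point stays in C1 \<union> C3.\<close>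
    define P where "P = closure (S2 - C2)"
    have zP: "zonal a P" unfolding P_def by (intro zonal_closure zonal_diff a z2)
    have "P \<subseteq> C1 \<union> C3"
      unfolding P_def using cover by (intro closure_minimal) (auto simp: C1_def C3_def)
    have AP: "A1 \<subseteq> P" unfolding P_def using sub disjC closure_subset[of "S2 - C2"] by blast
    \<comment> \<open>Points off the poles are chosen so that the common circle found from them is
      not degenerate.\<close>
    obtain p where p: "p \<in> A2" "(a \<bullet> p)\<^sup>2 < 1" using openin_sphere_nonpolar[OF op(2) ne a(1)] .
    obtain q where q: "q \<in> A1" "(a \<bullet> q)\<^sup>2 < 1" using openin_sphere_nonpolar[OF op(1) ne1 a(1)] .
    have cov: "S2 \<subseteq> C2 \<union> P" unfolding P_def using closure_subset[of "S2 - C2"] by blast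
    have "closed C2" "closed P" "P \<subseteq> S2"
      unfolding C2_def P_def by (simp_all add: closure_minimal)
    moreover have "p \<in> C2" "q \<in> P" using p q A_sub AP by auto
    ultimately obtain x where x: "x \<in> C2" "x \<in> P" "(a \<bullet> x)\<^sup>2 < 1"
      using zonal_cover_common_circle[OF a(1) _ C_sub(2) _ _ zP cov _ p(2) _ q(2)] by metis
    then have nx: "norm x = 1" using C_sub by auto
    have "rot a \<phi> x \<in> C1 \<union> C3" for \<phi>
      using zonalD[OF zP x(2)] \<open>P \<subseteq> C1 \<union> C3\<close> by blast
    then obtain l u where "l < u"
      and arc: "(\<forall>\<phi>\<in>{l<..<u}. rot a \<phi> x \<in> C1) \<or> (\<forall>\<phi>\<in>{l<..<u}. rot a \<phi> x \<in> C3)"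
      using rot_arc_in_one_of_two[of C1 a x C3] by (auto simp: C1_def)
    \<comment> \<open>The circle through \<open>x\<close> lies in the closure of A2, so every
      neighbourhood of a point on it meets A2, whereas A2 misses C1 \<union> C3.\<close>
    have no_interior: False
      if V: "open V" "rot a \<phi> x \<in> V" "V \<inter> S2 \<subseteq> C1 \<union> C3" for V \<phi>
    proof -
      have "rot a \<phi> x \<in> closure A2" using zonalD[OF z2 x(1)] by (simp add: C2_def)
      then obtain y where "y \<in> V" "y \<in> A2"
        using V open_Int_closure_eq_empty[of V A2] by blast
      then show False using V sub disjC by blast
    qed
    from arc show False
    proof
      assume arc1: "\<forall>\<phi>\<in>{l<..<u}. rot a \<phi> x \<in> C1"
      obtain \<phi> V where V: "open V" "rot a \<phi> x \<in> V" "V \<inter> S2 \<subseteq> C1"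
        by (rule zonal_arc_interior[OF a(1) nb b C_sub(1) z1 nx x(3) \<open>l < u\<close>])
           (use arc1 in blast)
      show False using no_interior[OF V(1,2)] V(3) by blast
    next
      assume arc3: "\<forall>\<phi>\<in>{l<..<u}. rot a \<phi> x \<in> C3"
      obtain \<phi> V where V: "open V" "rot a \<phi> x \<in> V" "V \<inter> S2 \<subseteq> C3"
        by (rule zonal_arc_interior[OF a(1) nc c C_sub(3) z3 nx x(3) \<open>l < u\<close>])
           (use arc3 in blast)
      show False using no_interior[OF V(1,2)] V(3) by blast
    qed
  qed
qed


end
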